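(* Let $m,n\in\frac1T\mathbb N$. Then $*^T_{m,m,m}$ induces a well-defined product on $A^T_m(V)$ making it an associative $\mathbb C$-algebra with identity the class of $\mathbf 1$, and $A^T_{n,m}(V)$ is an $A^T_n(V)$-$A^T_m(V)$-bimodule, where the left action of $A^T_n(V)$ is induced by $*^T_{n,n,m}$ and the right action of $A^T_m(V)$ is induced by $*^T_{n,m,m}$.
   Context: Throughout, $T$ is a positive integer and $V$ is a vertex algebra (vertex operator $Y(a,x)=\sum_{i\in\mathbb Z}a_ix^{-i-1}$, vacuum $\mathbf 1$) with a grading $V=\bigoplus_{i\ge\Delta}V_i$, $\Delta\in\mathbb Z_{\le0}$, such that $\mathbf 1\in V_0$ and $a_iV_j\subset V_{\mathrm{wt}a-1-i+j}$ for homogeneous $a$ ($\mathrm{wt}\,a=k$ for $a\in V_k$; $V_k=0$ for $k<\Delta$). $\mathbb N=\{0,1,2,\dots\}$. For rationals $i,j$, $\delta(i\le j)$ is $1$ if $i\le j$ and $0$ otherwise. For $i,j\in\frac1T\mathbb Z$, $\langle i-j\rangle$ is the unique integer $r$ with $0\le r\le T-1$ and $i-j-r/T\in\mathbb Z$. $\mathrm{Res}_x$ is the coefficient of $x^{-1}$; $(1+x)^c$ ($c\in\mathbb Q$) is $\sum_{k\ge0}\binom ckx^k$. For $f(z)=\sum_j\lambda_jz^j\in\mathbb C[z,z^{-1}]$ and $a,b\in V$, $f(z)|_{z^j=a_jb}=\sum_j\lambda_ja_jb$. Polynomial subspaces: for $N,q\in\mathbb Z$, $Q\in\mathbb Q$,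 $O(N,Q,q;z)\subset\mathbb C[z,z^{-1}]$ is spanned by $z^i$ ($i\ge N+1$) and $\sum_{i=0}^{N-q-j}\binom Qiz^{i+q+j}$ ($j=0,-1,-2,\dots$). For $m=l_1+i_1/T$, $n=l_3+i_3/T\in\frac1T\mathbb N$ ($l_1,l_3\in\mathbb N$, $0\le i_1,i_3\le T-1$), $\alpha,\beta\in\mathbb Z$, $s\in\{0,\dots,T-1\}$: $\mathcal O^{T,s}_{n,m}(\alpha,\beta;z)=O(\alpha+\beta-1-\Delta,\ \alpha-1+l_1+\delta(s\le i_1)+s/T,\ -l_1-l_3-\delta(s\le i_1)-\delta(T\le s+i_3)-1;z)$, and $\mathcal O^T_{n,m}(\alpha,\beta;z)=\bigcap_s\mathcal O^{T,s}_{n,m}(\alpha,\beta;z)$. Idempotent polynomials: put $N=\alpha+\beta-1-\Delta$ and $D=N+l_1+l_3+3$. For $r\in\{0,\dots,T-1\}$ and $i\in\mathbb Z$, $e^{T,r}_{n,m}(\alpha,\beta,i;z)=0$ if $i\ge N+1$ or $D\le0$; otherwise it is the unique Laurent polynomial in $\mathrm{span}\{z^k:N+1-TD\le k\le N\}$ with $e^{T,r}_{n,m}(\alpha,\beta,i;z)\equiv\delta_{r,s}z^i$ modulo $O(N,\alpha-1+l_1+\delta(s\le i_1)+s/T,-l_1-l_3-3;z)$ for every $s\in\{0,\dots,T-1\}$. Product: for $p=l_2+i_2/T\in\frac1T\mathbb N$ ($l_2\in\mathbb N$, $0\le i_2\le T-1$), let $r=\langle p-n\rangle$, $\mu=l_2-l_1-l_3-\delta(r\le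 i_1)-\delta(T\le r+i_3)$, and $P^T_{n,p,m}(\alpha,\beta;z)=\sum_{i=0}^{l_2}\binom{\mu}{i}\mathrm{Res}_x\Big((1+x)^{\alpha-1+l_1+\delta(r\le i_1)+r/T}x^{\mu-i}\sum_{j\in\mathbb Z}e^{T,r}_{n,m}(\alpha,\beta,j;z)x^{-j-1}\Big)$. For homogeneous $a,b\in V$, $a*^T_{n,p,m}b=P^T_{n,p,m}(\mathrm{wt}\,a,\mathrm{wt}\,b;z)|_{z^j=a_jb}$, extended bilinearly. Subspaces of $V$: $O^T_{0,n,m}(V)$ is spanned by $a_{-2}\mathbf 1+(\mathrm{wt}\,a+m-n)a$ ($a$ homogeneous); $O^T_{1,n,m}(V)$ is spanned by $f(z)|_{z^j=a_jb}$ for homogeneous $a,b$ and $f\in\mathcal O^T_{n,m}(\mathrm{wt}\,a,\mathrm{wt}\,b;z)$; $O^T_{2,n,m}(V)$ is spanned by $u*^T_{n,p_3,m}\big((a*^T_{p_3,p_2,p_1}b)*^T_{p_3,p_1,m}c-a*^T_{p_3,p_2,m}(b*^T_{p_2,p_1,m}c)\big)$ for $a,b,c,u\in V$, $p_1,p_2,p_3\in\frac1T\mathbb N$; $O^T_{3,n,m}(V)$ is spanned by $(u*^T_{n,p_2,p_1}y)*^T_{n,p_1,m}c$ for $u,c\in V$, $p_1,p_2\in\frac1T\mathbb N$, $y\in O^T_{0,p_2,p_1}(V)+O^T_{1,p_2,p_1}(V)$. $O^T_{n,m}(V)=\sum_{k=0}^3O^T_{k,n,m}(V)$, $A^T_{n,m}(V)=V/O^T_{n,m}(V)$,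 and $A^T_m(V)=A^T_{m,m}(V)$. *)

theory Defs
  imports Complex_Main
begin

text \<open>A vertex algebra with grading is bundled in a record: the complex scalar
multiplication, the modes Y a i b = a_i b, the vacuum, the graded pieces V_k and
the lower bound Delta of the grading.\<close>

record 'v gVA =
  scl  :: "complex \<Rightarrow> 'v \<Rightarrow> 'v"
  md   :: "'v \<Rightarrow> int \<Rightarrow> 'v \<Rightarrow> 'v"
  vac  :: "'v"
  grd  :: "int \<Rightarrow> 'v set"
  Dlt  :: int

definition graded_VA :: "('v::ab_group_add) gVA \<Rightarrow> bool" where
  "graded_VA V \<longleftrightarrow>
     vector_space (scl V)
   \<and> (\<forall>k. module.subspace (scl V) (grd V k))
   \<comment> \<open>V is the direct sum of the V_k\<close>
   \<and> (\<forall>v. \<exists>!f. finite {k. f k \<noteq> 0} \<and> (\<forall>k. f k \<in> grd V k)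
                \<and> v = (\<Sum>k\<in>{k. f k \<noteq> 0}. f k))
   \<and> Dlt V \<le> 0
   \<and> (\<forall>k. k < Dlt V \<longrightarrow> grd V k = {0})
   \<and> vac V \<in> grd V 0
   \<comment> \<open>bilinearity of the modes\<close>
   \<and> (\<forall>a i. Vector_Spaces.linear (scl V) (scl V) (md V a i))
   \<and> (\<forall>i b. Vector_Spaces.linear (scl V) (scl V) (\<lambda>a. md V a i b))
   \<comment> \<open>compatibility with the grading\<close>
   \<and> (\<forall>a b k j i. a \<in> grd V k \<longrightarrow> b \<in> grd V j \<longrightarrow> md V a i b \<in> grd V (k - 1 - i + j))
   \<comment> \<open>vacuum axiom and creation property\<close>
   \<and> (\<forall>i b. md V (vac V) i b = (if i = -1 then b else 0))
   \<and> (\<forall>a i. i \<ge> 0 \<longrightarrow> md V a i (vac V) = 0)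
   \<and> (\<forall>a. md V a (-1) (vac V) = a)
   \<comment> \<open>Borcherds (Jacobi) identity in modes; the sums are finite and M bounds them\<close>
   \<and> (\<forall>a b c p q r M. (\<forall>i\<ge>M. md V a (r + int i) b = 0 \<and> md V b (q + int i) c = 0
                                   \<and> md V a (p + int i) c = 0) \<longrightarrow>
        (\<Sum>i<M. scl V (of_int p gchoose i) (md V (md V a (r + int i) b) (p + q - int i) c))
      = (\<Sum>i<M. scl V ((-1) ^ i * (of_int r gchoose i))
              (md V a (p + r - int i) (md V b (q + int i) c)
               - scl V ((-1) powi r) (md V b (q + r - int i) (md V a (p + int i) c)))))"

definition comp :: "('v::ab_group_add) gVA \<Rightarrow> 'v \<Rightarrow> int \<Rightarrow> 'v" where
  "comp V v = (THE f. finite {k. f k \<noteq> 0}\<and> (\<forall>k. f k \<in> grd V k) \<and> v = (\<Sum>k\<in>{k. f k \<noteq> 0}. f k))"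

definition bilin :: "(complex \<Rightarrow> 'v::ab_group_add \<Rightarrow> 'v) \<Rightarrow> ('v \<Rightarrow> 'v \<Rightarrow> 'v) \<Rightarrow> bool" where
  "bilin sc f \<longleftrightarrow> (\<forall>x. Vector_Spaces.linear sc sc (f x)) \<and> (\<forall>y. Vector_Spaces.linear sc sc (\<lambda>x. f x y))"

section \<open>Laurent polynomials in z, as finitely supported coefficient functions\<close>

definition mono :: "int \<Rightarrow> int \<Rightarrow> complex" where
  "mono i = (\<lambda>k. if k = i then 1 else 0)"

definition fspan :: "(int \<Rightarrow> complex) set \<Rightarrow> (int \<Rightarrow> complex) set" where
  "fspan G = {(\<lambda>k. \<Sum>g\<in>S. c g * g k) | S c. finite S \<and> S \<subseteq> G}"

definition Opoly :: "int \<Rightarrow> complex \<Rightarrow> int \<Rightarrow> (int \<Rightarrow> complex) set" where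
  "Opoly N Q q = fspan ({mono i | i. i \<ge> N + 1}
      \<union> {(\<lambda>k. \<Sum>i\<in>{0..N - q - j}. (Q gchoose nat i) * mono (i + q + j) k) | j. j \<le> 0})"

text \<open>Elements of (1/T)N are encoded by naturals: mm encodes m = mm/T,
  with l = mm div T and i = mm mod T.\<close>
definition dl :: "bool \<Rightarrow> int" where "dl b = (if b then 1 else 0)"

definition Qs :: "nat \<Rightarrow> nat \<Rightarrow> int \<Rightarrow> nat \<Rightarrow> complex" where
  "Qs T mm \<alpha> s = of_int (\<alpha> - 1 + int (mm div T) + dl (s \<le> mm mod T)) + of_nat s / of_nat T"

definition OTs :: "int \<Rightarrow> nat \<Rightarrow> nat \<Rightarrow> nat \<Rightarrow> int \<Rightarrow> int \<Rightarrow> nat \<Rightarrow> (int \<Rightarrow> complex) set" where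
  "OTs \<Delta> T nn mm \<alpha> \<beta> s = Opoly (\<alpha> + \<beta> - 1 - \<Delta>) (Qs T mm \<alpha> s)
      (- int (mm div T) - int (nn div T) - dl (s \<le> mm mod T) - dl (T \<le> s + nn mod T) - 1)"

definition OT :: "int \<Rightarrow> nat \<Rightarrow> nat \<Rightarrow> nat \<Rightarrow> int \<Rightarrow> int \<Rightarrow> (int \<Rightarrow> complex) set" where
  "OT \<Delta> T nn mm \<alpha> \<beta> = (\<Inter>s\<in>{0..<T}. OTs \<Delta> T nn mm \<alpha> \<beta> s)"

definition idem :: "int \<Rightarrow> nat \<Rightarrow> nat \<Rightarrow> nat \<Rightarrow> int \<Rightarrow> int \<Rightarrow> nat \<Rightarrow> int \<Rightarrow> (int \<Rightarrow> complex)" where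
  "idem \<Delta> T nn mm \<alpha> \<beta> r i =
    (let N = \<alpha> + \<beta> - 1 - \<Delta>; D = N + int (mm div T) + int (nn div T) + 3 in
     if i \<ge> N + 1 \<or> D \<le> 0 then (\<lambda>_. 0)
     else (THE e. (\<forall>k. e k \<noteq> 0 \<longrightarrow> N + 1 - int T * D \<le> k \<and> k \<le> N)
             \<and> (\<forall>s<T. (\<lambda>k. e k - (if r = s then mono i k else 0))
                      \<in> Opoly N (Qs T mm \<alpha> s) (- int (mm div T) - int (nn div T) - 3))))"

text \<open>The product polynomial P^T_{n,p,m}(alpha,beta;z); the residue
  Res_x((1+x)^c x^(mu-i) sum_j e_j(z) x^(-j-1)) is written out as
  sum_{j >= mu-i} binom(c, j-mu+i) e_j(z) (e_j = 0 for j > N).\<close>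
definition Ppoly :: "int \<Rightarrow> nat \<Rightarrow> nat \<Rightarrow> nat \<Rightarrow> nat \<Rightarrow> int \<Rightarrow> int \<Rightarrow> (int \<Rightarrow> complex)" where
  "Ppoly \<Delta> T nn pp mm \<alpha> \<beta> =
    (let N = \<alpha> + \<beta> - 1 - \<Delta>;
         r = nat ((int pp - int nn) mod int T);
         \<mu> = int (pp div T) - int (mm div T) - int (nn div T) - dl (r \<le> mm mod T) - dl (T \<le> r + nn mod T);
         c = Qs T mm \<alpha> r
     in (\<lambda>k. \<Sum>i\<in>{0..pp div T}. (of_int \<mu> gchoose i) *
            (\<Sum>j\<in>{\<mu> - int i..N}. (c gchoose nat (j - \<mu> + int i)) * idem \<Delta> T nn mm \<alpha> \<beta> r j k)))"

definition apl :: "('v::ab_group_add) gVA \<Rightarrow> (int \<Rightarrow> complex) \<Rightarrow> 'v \<Rightarrow> 'v \<Rightarrow> 'v" where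
  "apl V f a b = (\<Sum>k\<in>{k. f k \<noteq> 0}. scl V (f k) (md V a k b))"

definition star :: "('v::ab_group_add) gVA \<Rightarrow> nat \<Rightarrow> nat \<Rightarrow> nat \<Rightarrow> nat \<Rightarrow> 'v \<Rightarrow> 'v \<Rightarrow> 'v" where
  "star V T nn pp mm a b =
     (\<Sum>\<alpha>\<in>{k. comp V a k \<noteq> 0}. \<Sum>\<beta>\<in>{k. comp V b k \<noteq> 0}.
        apl V (Ppoly (Dlt V) T nn pp mm \<alpha> \<beta>) (comp V a \<alpha>) (comp V b \<beta>))"

definition O0 :: "('v::ab_group_add) gVA \<Rightarrow> nat \<Rightarrow> nat \<Rightarrow> nat \<Rightarrow> 'v set" where
  "O0 V T nn mm = module.span (scl V)
     {md V a (-2) (vac V) + scl V (of_int k + (of_nat mm - of_nat nn) / of_nat T) a | a k. a \<in> grd V k}"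

definition O1 :: "('v::ab_group_add) gVA \<Rightarrow> nat \<Rightarrow> nat \<Rightarrow> nat \<Rightarrow> 'v set" where
  "O1 V T nn mm = module.span (scl V)
     {apl V f a b | a b \<alpha> \<beta> f. a \<in> grd V \<alpha> \<and> b \<in> grd V \<beta> \<and> f \<in> OT (Dlt V) T nn mm \<alpha> \<beta>}"

definition O2 :: "('v::ab_group_add) gVA \<Rightarrow> nat \<Rightarrow> nat \<Rightarrow> nat \<Rightarrow> 'v set" where
  "O2 V T nn mm = module.span (scl V)
     {star V T nn p3 mm u (star V T p3 p1 mm (star V T p3 p2 p1 a b) c
                            - star V T p3 p2 mm a (star V T p2 p1 mm b c)) | u a b c p1 p2 p3. True}"

definition O3 :: "('v::ab_group_add) gVA \<Rightarrow> nat \<Rightarrow> nat \<Rightarrow> nat \<Rightarrow> 'v set" where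
  "O3 V T nn mm = module.span (scl V)
     {star V T nn p1 mm (star V T nn p2 p1 u y) c | u c p1 p2 y.
        y \<in> {x + w | x w. x \<in> O0 V T p2 p1 \<and> w \<in> O1 V T p2 p1}}"

definition Otot :: "('v::ab_group_add) gVA \<Rightarrow> nat \<Rightarrow> nat \<Rightarrow> nat \<Rightarrow> 'v set" where
  "Otot V T nn mm = module.span (scl V) (O0 V T nn mm \<union> O1 V T nn mm \<union> O2 V T nn mm \<union> O3 V T nn mm)"

end

theory Submission
  imports
    Defs
    "HOL-Library.Function_Algebras"
    "HOL-Computational_Algebra.Formal_Power_Series"
    "HOL-Computational_Algebra.Polynomial"
begin

text \<open>Pairing a Laurent polynomial \<open>f\<close> with \<open>(1 + x)\<^sup>\<rho>\<close> by \<open>f \<mapsto> Res\<^sub>x (1 + x)\<^sup>\<rho> x\<^sup>-\<^sup>N\<^sup>-\<^sup>1 f(x)\<close>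
  turns \<open>z\<^sup>k\<close> into the polynomial \<open>binom(\<rho>, N - k)\<close> in \<open>\<rho>\<close>, and \<open>O(N, Q, q; z)\<close> becomes the set of
  those \<open>f\<close> whose residues vanish at the nodes \<open>\<rho> = d - Q\<close>, \<open>0 \<le> d < N - q\<close>. For different residues
  \<open>s\<close> modulo \<open>T\<close> these node sets are disjoint, so the idempotent polynomials exist and are unique by
  interpolation.

  The vacuum is a unit because \<open>1\<^sub>k b\<close> and, modulo \<open>O\<^sub>0\<close>, \<open>a\<^sub>k 1\<close> are the multiples \<open>binom(\<rho>, -1 - k)\<close> of \<open>b\<close>
  and \<open>a\<close> for a node \<open>\<rho>\<close>, and the residue of the product polynomial at that node is 1 by Vandermonde's
  convolution. Hence \<open>1 * b = b\<close> exactly and \<open>a * 1\<close> is congruent to \<open>a\<close> modulo \<open>O\<^sub>0\<close>.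

  Inserting the unit into the generators of \<open>O\<^sub>2\<close> and \<open>O\<^sub>3\<close> shows that \<open>O\<close> contains all associators,
  \<open>(O\<^sub>0 + O\<^sub>1) * V\<close> and \<open>V * (O\<^sub>0 + O\<^sub>1)\<close>. Products of the generators of \<open>O\<^sub>2\<close> and \<open>O\<^sub>3\<close> with arbitrary
  elements are then handled by reassociating, the main case being the pentagon identity.\<close>

section \<open>Binomial coefficients with integer lower index\<close>

definition zchoose :: "'a::field_char_0 \<Rightarrow> int \<Rightarrow> 'a" (infix "zchoose" 64) where
  "a zchoose k = (if k < 0 then 0 else a gchoose nat k)"

lemma zchoose_neg [simp]: "k < 0 \<Longrightarrow> a zchoose k = 0"
  and zchoose_nonneg: "0 \<le> k \<Longrightarrow> a zchoose k = a gchoose nat k"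
  by (simp_all add: zchoose_def)

lemma zchoose_of_nat [simp]: "a zchoose int k = a gchoose k"
  by (simp add: zchoose_def)

lemma zchoose_0_left: "0 zchoose k = (if k = 0 then 1 else 0)"
  by (simp add: zchoose_def gbinomial_0_left)

lemma of_nat_zchoose_eq_0: "int d < k \<Longrightarrow> of_nat d zchoose k = 0"
  by (simp add: zchoose_def flip: binomial_gbinomial)

lemma zchoose_Vandermonde:
  assumes "M \<le> B"
  shows "(\<Sum>k=A..B. (a zchoose (k - A)) * (b zchoose (M - k))) = (a + b) zchoose (M - A)"
proof (cases "A \<le> M")
  case True
  have "(\<Sum>k=A..B. (a zchoose (k - A)) * (b zchoose (M - k)))
      = (\<Sum>k=A..M. (a gchoose nat (k - A)) * (b gchoose nat (M - k)))"
    by (rule sum.mono_neutral_cong_right) (use assms in \<open>auto simp: zchoose_nonneg\<close>)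
  also have "\<dots> = (\<Sum>i=0..nat (M - A). (a gchoose i) * (b gchoose (nat (M - A) - i)))"
    by (rule sum.reindex_bij_witness[of _ "\<lambda>i. A + int i" "\<lambda>k. nat (k - A)"])
       (use True in \<open>auto simp: nat_diff_distrib' intro!: arg_cong2[where f = "(gchoose)"]\<close>)
  also have "\<dots> = (a + b) gchoose nat (M - A)" by (rule gbinomial_Vandermonde)
  finally show ?thesis using True by (simp add: zchoose_nonneg)
next
  case False
  then show ?thesis by (auto intro!: sum.neutral simp: zchoose_def)
qed

lemma minus_one_power_gbinomial_minus_two:
  "(-1) ^ k * ((-2) gchoose k) = (of_nat (Suc k) :: 'a::field_char_0)"
proof -
  have "((-2) gchoose k :: 'a) = (-1) ^ k * (of_nat (Suc k) gchoose k)"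
    by (subst gbinomial_negated_upper) simp
  then show ?thesis
    by (simp del: of_nat_Suc flip: mult.assoc power_mult_distrib binomial_gbinomial)
qed

section \<open>Interpolation by binomial coefficients\<close>

lemma interpolation_insert:
  fixes \<phi> :: "nat \<Rightarrow> 'i \<Rightarrow> 'a::field"
  assumes "finite S" "a \<notin> S"
    and interpolation: "\<And>y. \<exists>c. \<forall>i\<in>S. (\<Sum>j<card S. c j * \<phi> j i) = y i"
    and unisolvent: "\<And>c. (\<And>i. i \<in> insert a S \<Longrightarrow> (\<Sum>j<Suc (card S). c j * \<phi> j i) = 0) \<Longrightarrow> c (card S) = 0"
  shows "\<exists>c. \<forall>i\<in>insert a S. (\<Sum>j<Suc (card S). c j * \<phi> j i) = y i"
proof -
  obtain w where w_interpolates: "\<And>i. i \<in> S \<Longrightarrow> (\<Sum>j<card S. w j * \<phi> j i) = \<phi> (card S) i"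
    using interpolation[of "\<phi> (card S)"] by blast
  obtain c where c_interpolates: "\<And>i. i \<in> S \<Longrightarrow> (\<Sum>j<card S. c j * \<phi> j i) = y i"
    using interpolation[of y] by blast
  define nodal where "nodal j = (if j = card S then 1 else - w j)" for j
  define \<omega> where "\<omega> i = (\<Sum>j<Suc (card S). nodal j * \<phi> j i)" for i
  have \<omega>_eq_0: "\<omega> i = 0" if "i \<in> S" for i
    using w_interpolates[OF that] by (simp add: \<omega>_def nodal_def sum_negf)
  have "\<omega> a \<noteq> 0"
  proof
    assume "\<omega> a = 0"
    with \<omega>_eq_0 have "(\<Sum>j<Suc (card S). nodal j * \<phi> j i) = 0" if "i \<in> insert a S" for i
      using that unfolding \<omega>_def by blast
    then have "nodal (card S) = 0" by (rule unisolvent)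
    then show False by (simp add: nodal_def)
  qed
  define t where "t = (y a - (\<Sum>j<card S. c j * \<phi> j a)) / \<omega> a"
  define c' where "c' j = (if j < card S then c j else 0) + t * nodal j" for j
  have "(\<Sum>j<Suc (card S). c' j * \<phi> j i) = (\<Sum>j<card S. c j * \<phi> j i) + t * \<omega> i" for i
    unfolding \<omega>_def sum_distrib_left by (simp add: c'_def distrib_right sum.distrib mult.assoc)
  moreover have "(\<Sum>j<card S. c j * \<phi> j i) + t * \<omega> i = y i" if "i \<in> insert a S" for i
    using that c_interpolates \<omega>_eq_0 \<open>\<omega> a \<noteq> 0\<close> by (auto simp: t_def)
  ultimately have "\<forall>i\<in>insert a S. (\<Sum>j<Suc (card S). c' j * \<phi> j i) = y i" by simp
  then show ?thesis by (rule exI[of _ c'])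
qed

lemma unisolvent_interpolation:
  fixes \<phi> :: "nat \<Rightarrow> 'i \<Rightarrow> 'a::field"
  assumes "finite I"
    and unisolvent: "\<And>S c j. S \<subseteq> I \<Longrightarrow> (\<And>i. i \<in> S \<Longrightarrow> (\<Sum>j<card S. c j * \<phi> j i) = 0) \<Longrightarrow> j < card S \<Longrightarrow> c j = 0"
  shows "\<exists>c. \<forall>i\<in>I. (\<Sum>j<card I. c j * \<phi> j i) = y i"
  using \<open>finite I\<close> unisolvent
proof (induction I arbitrary: y rule: finite_induct)
  case empty
  show ?case by simp
next
  case (insert a S)
  have card: "card (insert a S) = Suc (card S)" using insert.hyps by simp
  show ?case
    unfolding card
  proof (rule interpolation_insert[OF insert.hyps])
    show "\<exists>c. \<forall>i\<in>S. (\<Sum>j<card S. c j * \<phi> j i) = y i" for y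
      using insert.prems by (intro insert.IH) blast
    show "c (card S) = 0" if "\<And>i. i \<in> insert a S \<Longrightarrow> (\<Sum>j<Suc (card S). c j * \<phi> j i) = 0" for c
      using insert.prems[OF order_refl, of c "card S"] that unfolding card by blast
  qed
qed

definition gchoose_poly :: "nat \<Rightarrow> 'a::field_char_0 poly" where
  "gchoose_poly j = smult (1 / fact j) (\<Prod>i = 0..<j. [:- of_nat i, 1:])"

lemma poly_gchoose_poly: "poly (gchoose_poly j) x = x gchoose j"
  by (simp add: gchoose_poly_def poly_prod gbinomial_prod_rev)

lemma gchoose_poly_nonzero [simp]: "gchoose_poly j \<noteq> (0 :: 'a::field_char_0 poly)"
  by (simp add: gchoose_poly_def)

lemma degree_gchoose_poly: "degree (gchoose_poly j :: 'a::field_char_0 poly) = j"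
  by (simp add: gchoose_poly_def degree_prod_eq_sum_degree)

lemma gchoose_poly_linear_independent:
  assumes "(\<Sum>j<M. smult (c j) (gchoose_poly j)) = 0" "j < M"
  shows "c j = 0"
  using assms
proof (induction M)
  case (Suc M)
  have "(\<Sum>j<M. c j * coeff (gchoose_poly j) M) = 0"
    by (rule sum.neutral) (simp add: coeff_eq_0 degree_gchoose_poly)
  then have "coeff (\<Sum>j<Suc M. smult (c j) (gchoose_poly j)) M = c M * lead_coeff (gchoose_poly M)"
    by (simp add: coeff_sum degree_gchoose_poly)
  then have "c M = 0" using Suc.prems(1) by (simp del: sum.lessThan_Suc)
  then show ?case using Suc by (cases "j = M") simp_all
qed simp

lemma gchoose_combination_eq_0:
  fixes x :: "'i \<Rightarrow> 'a::field_char_0"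
  assumes "inj_on x I" and vanishes: "\<And>i. i \<in> I \<Longrightarrow> (\<Sum>j<card I. c j * (x i gchoose j)) = 0"
    and "j < card I"
  shows "c j = 0"
proof -
  define p where "p = (\<Sum>j<card I. smult (c j) (gchoose_poly j))"
  have "card (x ` I) = card I" by (simp add: card_image \<open>inj_on x I\<close>)
  moreover have "degree p < card I"
    unfolding p_def using \<open>j < card I\<close>
    by (intro degree_sum_less) (auto simp: degree_gchoose_poly intro: le_less_trans[OF degree_smult_le])
  moreover have "poly p z = 0" if "z \<in> x ` I" for z
    using that vanishes by (auto simp: p_def poly_sum poly_gchoose_poly)
  ultimately have "p = 0"
    using \<open>j < card I\<close> by (intro poly_eqI_degree[of "x ` I"]) auto
  then show ?thesis
    using gchoose_poly_linear_independent \<open>j < card I\<close> unfolding p_def by blast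
qed

lemma gchoose_interpolation:
  fixes x :: "'i \<Rightarrow> 'a::field_char_0"
  assumes "finite I" "inj_on x I"
  shows "\<exists>c. \<forall>i\<in>I. (\<Sum>j<card I. c j * (x i gchoose j)) = y i"
  using \<open>finite I\<close>
proof (rule unisolvent_interpolation)
  fix S c j
  assume "S \<subseteq> I" "\<And>i. i \<in> S \<Longrightarrow> (\<Sum>j<card S. c j * (x i gchoose j)) = 0" "j < card S"
  then show "c j = 0"
    using gchoose_combination_eq_0 inj_on_subset[OF \<open>inj_on x I\<close>] by blast
qed

section \<open>Laurent polynomials and their residues against binomial series\<close>

definition fscale :: "complex \<Rightarrow> (int \<Rightarrow> complex) \<Rightarrow> int \<Rightarrow> complex" where
  "fscale c f = (\<lambda>k. c * f k)"

interpretation laurent: vector_space fscale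
  by standard (auto simp: fscale_def fun_eq_iff algebra_simps)

lemma fscale_apply [simp]: "fscale c f k = c * f k"
  by (simp add: fscale_def)

lemma sum_fun_apply: "(\<Sum>x\<in>A. F x) k = (\<Sum>x\<in>A. F x k)" for F :: "'a \<Rightarrow> 'b \<Rightarrow> 'c::comm_monoid_add"
  by (induction A rule: infinite_finite_induct) auto

lemma fspan_eq_span: "fspan G = laurent.span G"
  unfolding fspan_def laurent.span_explicit
proof (intro Collect_cong iff_exI arg_cong2[where f = "(\<and>)"] refl)
  fix f S c
  show "(f = (\<lambda>k. \<Sum>g\<in>S. c g * g k)) = (f = (\<Sum>g\<in>S. fscale (c g) g))"
    by (simp add: fun_eq_iff sum_fun_apply)
qed

definition laurent_on :: "int set \<Rightarrow> (int \<Rightarrow> complex) set" where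
  "laurent_on A = {f. finite {k. f k \<noteq> 0} \<and> {k. f k \<noteq> 0} \<subseteq> A}"

lemma laurent_onI: "finite S \<Longrightarrow> S \<subseteq> A \<Longrightarrow> (\<And>k. f k \<noteq> 0 \<Longrightarrow> k \<in> S) \<Longrightarrow> f \<in> laurent_on A"
  unfolding laurent_on_def using finite_subset[of "{k. f k \<noteq> 0}" S] by auto

lemma laurent_on_finite_iff: "finite A \<Longrightarrow> f \<in> laurent_on A \<longleftrightarrow> (\<forall>k. f k \<noteq> 0 \<longrightarrow> k \<in> A)"
  unfolding laurent_on_def using finite_subset[of "{k. f k \<noteq> 0}" A] by auto

lemma laurent_on_mono: "f \<in> laurent_on A \<Longrightarrow> A \<subseteq> B \<Longrightarrow> f \<in> laurent_on B"
  by (auto simp: laurent_on_def)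

lemma laurent_on_imp_UNIV: "f \<in> laurent_on A \<Longrightarrow> f \<in> laurent_on UNIV"
  by (simp add: laurent_on_def)

lemma mono_laurent_on: "i \<in> A \<Longrightarrow> mono i \<in> laurent_on A"
  by (rule laurent_onI[of "{i}"]) (auto simp: mono_def split: if_splits)

lemma subspace_laurent_on: "laurent.subspace (laurent_on A)"
proof (rule laurent.subspaceI)
  show "f + g \<in> laurent_on A" if "f \<in> laurent_on A" "g \<in> laurent_on A" for f g
    by (rule laurent_onI[of "{k. f k \<noteq> 0} \<union> {k. g k \<noteq> 0}"]) (use that in \<open>auto simp: laurent_on_def\<close>)
  show "fscale c f \<in> laurent_on A" if "f \<in> laurent_on A" for c f
    by (rule laurent_onI[of "{k. f k \<noteq> 0}"]) (use that in \<open>auto simp: laurent_on_def\<close>)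
qed (simp add: laurent_on_def)

lemma laurent_on_expansion:
  assumes "finite A" "f \<in> laurent_on A"
  shows "f = (\<Sum>k\<in>A. fscale (f k) (mono k))"
proof
  fix j
  have "(\<Sum>k\<in>A. fscale (f k) (mono k)) j = (\<Sum>k\<in>A. if j = k then f k else 0)"
    unfolding sum_fun_apply by (rule sum.cong) (auto simp: mono_def)
  then show "f j = (\<Sum>k\<in>A. fscale (f k) (mono k)) j"
    using assms by (auto simp: laurent_on_finite_iff)
qed

text \<open>\<open>Res\<^sub>x (1 + x)\<^sup>\<rho> x\<^sup>-\<^sup>M\<^sup>-\<^sup>1 f(x)\<close>, that is, the coefficient of \<open>x\<^sup>M\<close> in \<open>(1 + x)\<^sup>\<rho> f(x)\<close>.\<close>
definition binom_residue :: "complex \<Rightarrow> int \<Rightarrow> (int \<Rightarrow> complex) \<Rightarrow> complex" where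
  "binom_residue \<rho> M f = (\<Sum>k | f k \<noteq> 0. f k * (\<rho> zchoose (M - k)))"

lemma binom_residue_eq_sum:
  assumes "finite A" "f \<in> laurent_on A"
  shows "binom_residue \<rho> M f = (\<Sum>k\<in>A. f k * (\<rho> zchoose (M - k)))"
  unfolding binom_residue_def by (rule sum.mono_neutral_left) (use assms in \<open>auto simp: laurent_on_def\<close>)

lemma binom_residue_0 [simp]: "binom_residue \<rho> M 0 = 0"
  by (simp add: binom_residue_def)

lemma binom_residue_mono [simp]: "binom_residue \<rho> M (mono i) = \<rho> zchoose (M - i)"
  using binom_residue_eq_sum[of "{i}" "mono i"] by (simp add: mono_laurent_on) (simp add: mono_def)

lemma binom_residue_add:
  assumes "f \<in> laurent_on UNIV" "g \<in> laurent_on UNIV"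
  shows "binom_residue \<rho> M (f + g) = binom_residue \<rho> M f + binom_residue \<rho> M g"
proof -
  let ?A = "{k. f k \<noteq> 0} \<union> {k. g k \<noteq> 0}"
  have finite_A: "finite ?A" using assms by (simp add: laurent_on_def)
  then have "f \<in> laurent_on ?A" "g \<in> laurent_on ?A" by (auto intro: laurent_onI)
  then show ?thesis
    using laurent.subspace_add[OF subspace_laurent_on]
    by (simp add: binom_residue_eq_sum[OF finite_A] distrib_right sum.distrib)
qed

lemma binom_residue_scale: "binom_residue \<rho> M (fscale c f) = c * binom_residue \<rho> M f"
  by (cases "c = 0") (simp_all add: binom_residue_def sum_distrib_left mult.assoc)

lemma binom_residue_diff:
  assumes "f \<in> laurent_on UNIV" "g \<in> laurent_on UNIV"
  shows "binom_residue \<rho> M (f - g) = binom_residue \<rho> M f - binom_residue \<rho> M g"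
  using binom_residue_add[OF laurent.subspace_diff[OF subspace_laurent_on assms] assms(2)] by simp

lemma binom_residue_lincomb:
  assumes "\<And>x. x \<in> A \<Longrightarrow> F x \<in> laurent_on UNIV"
  shows "binom_residue \<rho> M (\<Sum>x\<in>A. fscale (c x) (F x)) = (\<Sum>x\<in>A. c x * binom_residue \<rho> M (F x))"
  using assms
proof (induction A rule: infinite_finite_induct)
  case (insert x A)
  have "fscale (c x) (F x) \<in> laurent_on UNIV" "(\<Sum>x\<in>A. fscale (c x) (F x)) \<in> laurent_on UNIV"
    by (intro laurent.subspace_scale laurent.subspace_sum subspace_laurent_on insert.prems; simp)+
  then show ?case
    unfolding sum.insert[OF insert.hyps(1,2)]
    using insert.IH insert.prems by (simp only: binom_residue_add binom_residue_scale insertI2)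
qed simp_all

lemma subspace_binom_residue_kernel:
  "laurent.subspace {f \<in> laurent_on UNIV. binom_residue \<rho> M f = 0}"
  using subspace_laurent_on[of UNIV]
  by (auto simp: laurent.subspace_def binom_residue_add binom_residue_scale)

lemma binom_residue_newton:
  assumes "f \<in> laurent_on {N - int M<..N}"
  shows "binom_residue \<rho> N f = (\<Sum>j<M. f (N - int j) * (\<rho> gchoose j))"
proof -
  have "binom_residue \<rho> N f = (\<Sum>k\<in>{N - int M<..N}. f k * (\<rho> zchoose (N - k)))"
    by (rule binom_residue_eq_sum[OF _ assms]) simp
  also have "\<dots> = (\<Sum>j<M. f (N - int j) * (\<rho> gchoose j))"
    by (rule sum.reindex_bij_witness[of _ "\<lambda>j. N - int j" "\<lambda>k. nat (N - k)"])
       (auto simp: zchoose_nonneg)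
  finally show ?thesis .
qed

lemma binom_residues_eq_0_imp_eq_0:
  assumes "inj_on x I" and support: "f \<in> laurent_on {N - int (card I)<..N}"
    and vanishes: "\<And>i. i \<in> I \<Longrightarrow> binom_residue (x i) N f = 0"
  shows "f = 0"
proof
  fix k
  have "f (N - int j) = 0" if "j < card I" for j
    by (rule gchoose_combination_eq_0[OF \<open>inj_on x I\<close> _ that, of "\<lambda>j. f (N - int j)"])
       (simp add: vanishes flip: binom_residue_newton[OF support])
  from this[of "nat (N - k)"] support show "f k = 0 k"
    by (cases "f k = 0") (auto simp: laurent_on_finite_iff nat_less_iff)
qed

lemma binom_residue_interpolation:
  assumes "finite I" "inj_on x I"
  shows "\<exists>!f. f \<in> laurent_on {N - int (card I)<..N} \<and> (\<forall>i\<in>I. binom_residue (x i) N f = y i)"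
proof (rule ex_ex1I)
  obtain c where c_interpolates: "\<And>i. i \<in> I \<Longrightarrow> (\<Sum>j<card I. c j * (x i gchoose j)) = y i"
    using gchoose_interpolation[OF assms] by blast
  define f where "f k = (if k \<in> {N - int (card I)<..N} then c (nat (N - k)) else 0)" for k
  have f_support: "f \<in> laurent_on {N - int (card I)<..N}"
    by (simp add: laurent_on_finite_iff f_def)
  then have "binom_residue (x i) N f = y i" if "i \<in> I" for i
    using c_interpolates[OF that] by (simp add: binom_residue_newton f_def)
  with f_support show "\<exists>f. f \<in> laurent_on {N - int (card I)<..N} \<and> (\<forall>i\<in>I. binom_residue (x i) N f = y i)"
    by blast
next
  fix f g
  assume "f \<in> laurent_on {N - int (card I)<..N} \<and> (\<forall>i\<in>I. binom_residue (x i) N f = y i)"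
    and "g \<in> laurent_on {N - int (card I)<..N} \<and> (\<forall>i\<in>I. binom_residue (x i) N g = y i)"
  then have f_interpolates: "f \<in> laurent_on {N - int (card I)<..N}"
      "\<And>i. i \<in> I \<Longrightarrow> binom_residue (x i) N f = y i"
    and g_interpolates: "g \<in> laurent_on {N - int (card I)<..N}"
      "\<And>i. i \<in> I \<Longrightarrow> binom_residue (x i) N g = y i"
    by simp_all
  have "f - g = 0"
  proof (rule binom_residues_eq_0_imp_eq_0[OF \<open>inj_on x I\<close>])
    show "f - g \<in> laurent_on {N - int (card I)<..N}"
      using laurent.subspace_diff[OF subspace_laurent_on f_interpolates(1) g_interpolates(1)] .
    show "binom_residue (x i) N (f - g) = 0" if "i \<in> I" for i
      using that by (simp add: f_interpolates(2) g_interpolates(2)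
          binom_residue_diff[OF f_interpolates(1)[THEN laurent_on_imp_UNIV]
            g_interpolates(1)[THEN laurent_on_imp_UNIV]])
  qed
  then show "f = g" by simp
qed

section \<open>The subspaces \<open>O(N, Q, q; z)\<close> and the idempotent polynomials\<close>

text \<open>The part of \<open>z\<^sup>p (1 + z)\<^sup>Q\<close> of degree at most \<open>N\<close>.\<close>
definition truncated_binomial :: "int \<Rightarrow> complex \<Rightarrow> int \<Rightarrow> int \<Rightarrow> complex" where
  "truncated_binomial N Q p = (\<lambda>k. if k \<le> N then Q zchoose (k - p) else 0)"

lemma truncated_binomial_laurent_on: "truncated_binomial N Q p \<in> laurent_on {p..N}"
  by (auto simp: laurent_on_finite_iff truncated_binomial_def zchoose_def split: if_splits)

lemma binom_residue_truncated_binomial: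
  assumes "M \<le> N"
  shows "binom_residue \<rho> M (truncated_binomial N Q p) = (Q + \<rho>) zchoose (M - p)"
  using zchoose_Vandermonde[OF assms, where A = p and a = Q and b = \<rho>]
  by (subst binom_residue_eq_sum[OF _ truncated_binomial_laurent_on]) (simp_all add: truncated_binomial_def)

lemma Opoly_eq_span:
  "Opoly N Q q = laurent.span (mono ` {N<..} \<union> truncated_binomial N Q ` {..q})"
proof -
  have "(\<lambda>k. \<Sum>i\<in>{0..N - q - j}. (Q gchoose nat i) * mono (i + q + j) k)
      = truncated_binomial N Q (q + j)" for j
  proof
    fix k
    have "(\<Sum>i\<in>{0..N - q - j}. (Q gchoose nat i) * mono (i + q + j) k)
        = (\<Sum>i\<in>{0..N - q - j}. if i = k - (q + j) then Q gchoose nat i else 0)"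
      by (rule sum.cong) (auto simp: mono_def)
    then show "(\<Sum>i\<in>{0..N - q - j}. (Q gchoose nat i) * mono (i + q + j) k)
        = truncated_binomial N Q (q + j) k"
      by (auto simp: truncated_binomial_def zchoose_def)
  qed
  then have "Opoly N Q q = laurent.span ({mono i | i. i \<ge> N + 1}
      \<union> {truncated_binomial N Q (q + j) | j. j \<le> 0})"
    by (simp add: Opoly_def fspan_eq_span)
  moreover have "{mono i | i. i \<ge> N + 1} = mono ` {N<..}" by auto
  moreover have "{truncated_binomial N Q (q + j) | j. j \<le> 0} = truncated_binomial N Q ` {..q}"
    by (force simp: image_iff intro: exI[of _ "_ - q"])
  ultimately show ?thesis by simp
qed

lemma subspace_Opoly: "laurent.subspace (Opoly N Q q)"
  by (simp add: Opoly_eq_span)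

lemma Opoly_binom_residue_eq_0:
  assumes "f \<in> Opoly N Q q" "M \<le> N" "int d < M - q"
  shows "f \<in> laurent_on UNIV" and "binom_residue (of_nat d - Q) M f = 0"
proof -
  have "mono i \<in> {f \<in> laurent_on UNIV. binom_residue (of_nat d - Q) M f = 0}" if "i > N" for i
    using that \<open>M \<le> N\<close> by (simp add: mono_laurent_on)
  moreover have "truncated_binomial N Q p \<in> {f \<in> laurent_on UNIV. binom_residue (of_nat d - Q) M f = 0}"
    if "p \<le> q" for p
    using that assms laurent_on_imp_UNIV[OF truncated_binomial_laurent_on]
    by (simp add: binom_residue_truncated_binomial of_nat_zchoose_eq_0)
  ultimately have "Opoly N Q q \<subseteq> {f \<in> laurent_on UNIV. binom_residue (of_nat d - Q) M f = 0}"
    unfolding Opoly_eq_span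
    by (intro laurent.span_minimal subspace_binom_residue_kernel) auto
  then show "f \<in> laurent_on UNIV" "binom_residue (of_nat d - Q) M f = 0"
    using assms(1) by auto
qed

lemma mono_in_span_Opoly_window:
  "mono k \<in> laurent.span (Opoly N Q q \<union> laurent_on {q<..N})" (is "_ \<in> ?R")
proof (induction "nat (N + 1 - k)" arbitrary: k rule: less_induct)
  case less
  consider "k > N" | "q < k" "k \<le> N" | "k \<le> q" "k \<le> N" by linarith
  then show ?case
  proof cases
    case 1
    then have "mono k \<in> Opoly N Q q"
      unfolding Opoly_eq_span by (intro laurent.span_base) simp
    then show ?thesis by (intro laurent.span_base) simp
  next
    case 2
    then show ?thesis by (intro laurent.span_base) (simp add: mono_laurent_on)
  next
    case 3
    let ?tail = "\<Sum>i\<in>{k<..N}. fscale (Q zchoose (i - k)) (mono i)"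
    have "truncated_binomial N Q k = (\<Sum>i\<in>{k..N}. fscale (Q zchoose (i - k)) (mono i))"
      by (subst laurent_on_expansion[OF _ truncated_binomial_laurent_on])
         (simp_all add: truncated_binomial_def)
    moreover have "{k..N} = insert k {k<..N}" using 3 by auto
    ultimately have "truncated_binomial N Q k = mono k + ?tail" by (simp add: zchoose_def)
    then have "mono k = truncated_binomial N Q k - ?tail" by simp
    moreover have "truncated_binomial N Q k \<in> Opoly N Q q"
      unfolding Opoly_eq_span using 3 by (intro laurent.span_base) simp
    then have "truncated_binomial N Q k \<in> ?R"
      by (intro laurent.span_base) simp
    moreover have "?tail \<in> ?R"
      by (intro laurent.span_sum laurent.span_scale less) auto
    ultimately show ?thesis by (simp only: laurent.span_diff)
  qed
qed

lemma Opoly_iff_binom_residue: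
  assumes laurent_f: "f \<in> laurent_on UNIV"
  shows "f \<in> Opoly N Q q \<longleftrightarrow> (\<forall>d. int d < N - q \<longrightarrow> binom_residue (of_nat d - Q) N f = 0)"
proof
  assume vanishes: "\<forall>d. int d < N - q \<longrightarrow> binom_residue (of_nat d - Q) N f = 0"
  have "f = (\<Sum>k | f k \<noteq> 0. fscale (f k) (mono k))"
    using laurent_f by (intro laurent_on_expansion) (auto simp: laurent_on_def)
  also have "\<dots> \<in> laurent.span (Opoly N Q q \<union> laurent_on {q<..N})"
    by (intro laurent.span_sum laurent.span_scale mono_in_span_Opoly_window)
  finally obtain g h where f_eq: "f = g + h" and g_Opoly: "g \<in> Opoly N Q q"
    and h_window: "h \<in> laurent_on {q<..N}"
    unfolding laurent.span_Un laurent.span_eq_iff[THEN iffD2, OF subspace_Opoly]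
      laurent.span_eq_iff[THEN iffD2, OF subspace_laurent_on] by blast
  have "h = 0"
  proof (rule binom_residues_eq_0_imp_eq_0)
    show "inj_on (\<lambda>d. of_nat d - Q) {..<nat (N - q)}" by (simp add: inj_on_def)
    show "h \<in> laurent_on {N - int (card {..<nat (N - q)})<..N}"
      by (rule laurent_on_mono[OF h_window]) auto
    fix d assume "d \<in> {..<nat (N - q)}"
    then have "int d < N - q" by simp
    note Opoly_binom_residue_eq_0[OF g_Opoly order_refl this]
    then have "binom_residue (of_nat d - Q) N (f - g) = 0"
      using vanishes laurent_f \<open>int d < N - q\<close> by (simp add: binom_residue_diff)
    then show "binom_residue (of_nat d - Q) N h = 0" by (simp add: f_eq)
  qed
  with f_eq g_Opoly show "f \<in> Opoly N Q q" by simp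
qed (use Opoly_binom_residue_eq_0 in blast)

lemma idempotent_polynomial_ex1:
  fixes Q :: "nat \<Rightarrow> complex"
  assumes inj_nodes: "inj_on (\<lambda>(s, d). of_nat d - Q s) ({..<T} \<times> UNIV)"
  shows "\<exists>!e. e \<in> laurent_on {N - int T * int D<..N}
    \<and> (\<forall>s<T. e - (if r = s then mono i else 0) \<in> Opoly N (Q s) (N - int D))"
proof -
  let ?I = "{..<T} \<times> {..<D}"
  let ?x = "\<lambda>(s, d). of_nat d - Q s"
  let ?y = "\<lambda>(s, d). if r = s then (of_nat d - Q s) zchoose (N - i) else 0"
  have mod_iff: "e - (if r = s then mono i else 0) \<in> Opoly N (Q s) (N - int D)
      \<longleftrightarrow> (\<forall>d<D. binom_residue (?x (s, d)) N e = ?y (s, d))"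
    if "e \<in> laurent_on {N - int T * int D<..N}" for e s
  proof -
    have laurent_e: "e \<in> laurent_on UNIV" using laurent_on_imp_UNIV[OF that] .
    have laurent_target: "(if r = s then mono i else 0) \<in> laurent_on UNIV"
      using laurent.subspace_0[OF subspace_laurent_on] by (simp add: mono_laurent_on)
    show ?thesis
      using laurent.subspace_diff[OF subspace_laurent_on laurent_e laurent_target]
      by (auto simp: Opoly_iff_binom_residue binom_residue_diff[OF laurent_e laurent_target])
  qed
  have "(e \<in> laurent_on {N - int T * int D<..N}
        \<and> (\<forall>s<T. e - (if r = s then mono i else 0) \<in> Opoly N (Q s) (N - int D)))
      \<longleftrightarrow> (e \<in> laurent_on {N - int (card ?I)<..N} \<and> (\<forall>j\<in>?I. binom_residue (?x j) N e = ?y j))" for e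
    by (intro conj_cong) (simp_all add: card_cartesian_product mod_iff, blast)
  moreover have "\<exists>!e. e \<in> laurent_on {N - int (card ?I)<..N} \<and> (\<forall>j\<in>?I. binom_residue (?x j) N e = ?y j)"
    by (rule binom_residue_interpolation) (auto intro: inj_on_subset[OF inj_nodes])
  ultimately show ?thesis by simp
qed

lemma inj_on_Qs_nodes:
  assumes "T > 0"
  shows "inj_on (\<lambda>(s, d). of_nat d - Qs T m \<alpha> s) ({..<T} \<times> UNIV)"
proof (rule inj_onI, clarsimp)
  fix s s' d d' :: nat
  assume "s < T" "s' < T" and nodes_eq: "complex_of_nat d - Qs T m \<alpha> s = of_nat d' - Qs T m \<alpha> s'"
  define z where "z = int d - int d' + dl (s' \<le> m mod T) - dl (s \<le> m mod T)"
  have "of_int (int s - int s') = (of_int (z * int T) :: complex)"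
    using nodes_eq assms by (simp add: Qs_def z_def field_simps)
  then have diff_eq: "int s - int s' = z * int T" unfolding of_int_eq_iff .
  have "\<bar>z * int T\<bar> < int T" using \<open>s < T\<close> \<open>s' < T\<close> unfolding diff_eq[symmetric] by auto
  then have "z = 0" using assms by (auto simp: abs_mult)
  with diff_eq have "s = s'" by simp
  with nodes_eq show "s = s' \<and> d = d'" by simp
qed

lemma idem_cong:
  assumes T_pos: "T > 0" and N_eq: "N = \<alpha> + \<beta> - 1 - \<Delta>" and "i \<le> N"
    and width_pos: "N + int (m div T) + int (n div T) + 3 > 0"
  shows "idem \<Delta> T n m \<alpha> \<beta> r i \<in> laurent_on UNIV"
    and "s < T \<Longrightarrow> idem \<Delta> T n m \<alpha> \<beta> r i - (if r = s then mono i else 0)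
      \<in> Opoly N (Qs T m \<alpha> s) (- int (m div T) - int (n div T) - 3)"
proof -
  define D where "D = nat (N + int (m div T) + int (n div T) + 3)"
  have width_eq: "int D = N + int (m div T) + int (n div T) + 3" using width_pos by (simp add: D_def)
  let ?P = "\<lambda>e. e \<in> laurent_on {N - int T * int D<..N}
      \<and> (\<forall>s<T. e - (if r = s then mono i else 0) \<in> Opoly N (Qs T m \<alpha> s) (N - int D))"
  have shift: "(\<lambda>k. e k - (if r = s then mono i k else 0)) = e - (if r = s then mono i else 0)" for e s
    by auto
  have window: "(\<forall>k. e k \<noteq> 0 \<longrightarrow> N + 1 - int T * int D \<le> k \<and> k \<le> N)
      \<longleftrightarrow> e \<in> laurent_on {N - int T * int D<..N}" for e
    by (auto simp: laurent_on_finite_iff)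
  have modulus_eq: "- int (m div T) - int (n div T) - 3 = N - int D"
    by (simp add: width_eq)
  have "\<not> (N + 1 \<le> i \<or> int D \<le> 0)" using \<open>i \<le> N\<close> width_pos width_eq by linarith
  then have idem_eq: "idem \<Delta> T n m \<alpha> \<beta> r i = (THE e. ?P e)"
    unfolding idem_def Let_def N_eq[symmetric] width_eq[symmetric] shift window modulus_eq by (rule if_not_P)
  have "\<exists>!e. ?P e" by (rule idempotent_polynomial_ex1[OF inj_on_Qs_nodes[OF T_pos]])
  then have "?P (idem \<Delta> T n m \<alpha> \<beta> r i)" unfolding idem_eq by (rule theI')
  then show "idem \<Delta> T n m \<alpha> \<beta> r i \<in> laurent_on UNIV"
    and "s < T \<Longrightarrow> idem \<Delta> T n m \<alpha> \<beta> r i - (if r = s then mono i else 0)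
      \<in> Opoly N (Qs T m \<alpha> s) (- int (m div T) - int (n div T) - 3)"
    by (auto simp: modulus_eq intro: laurent_on_imp_UNIV)
qed

lemma idem_laurent_on: "T > 0 \<Longrightarrow> idem \<Delta> T n m \<alpha> \<beta> r i \<in> laurent_on UNIV"
  using idem_cong(1)[of T] laurent.subspace_0[OF subspace_laurent_on]
  by (fastforce simp: idem_def Let_def not_le zero_fun_def)

lemma binom_residue_idem:
  assumes T_pos: "T > 0" and "r < T" and M_le: "M \<le> \<alpha> + \<beta> - 1 - \<Delta>"
    and h_less: "int h < M + int (m div T) + int (n div T) + 3"
  shows "binom_residue (of_nat h - Qs T m \<alpha> r) M (idem \<Delta> T n m \<alpha> \<beta> r i)
    = (of_nat h - Qs T m \<alpha> r) zchoose (M - i)"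
proof (cases "i \<le> \<alpha> + \<beta> - 1 - \<Delta>")
  case True
  have "idem \<Delta> T n m \<alpha> \<beta> r i - mono i
      \<in> Opoly (\<alpha> + \<beta> - 1 - \<Delta>) (Qs T m \<alpha> r) (- int (m div T) - int (n div T) - 3)"
    using idem_cong(2)[OF T_pos refl True _ \<open>r < T\<close>, of m n r] M_le h_less by simp
  from Opoly_binom_residue_eq_0(2)[OF this M_le, of h] h_less show ?thesis
    by (simp add: binom_residue_diff idem_laurent_on[OF T_pos] mono_laurent_on)
next
  case False
  then have "idem \<Delta> T n m \<alpha> \<beta> r i = 0" by (simp add: idem_def Let_def zero_fun_def)
  with False M_le show ?thesis by simp
qed

section \<open>The product polynomials\<close>

text \<open>\<open>residue_index T p n\<close> is the paper's \<open>\<langle>p - n\<rangle>\<close>, and \<open>Ppoly_exponent\<close> its \<open>\<mu>\<close>.\<close>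
definition residue_index :: "nat \<Rightarrow> nat \<Rightarrow> nat \<Rightarrow> nat" where
  "residue_index T p n = nat ((int p - int n) mod int T)"

definition Ppoly_exponent :: "nat \<Rightarrow> nat \<Rightarrow> nat \<Rightarrow> nat \<Rightarrow> int" where
  "Ppoly_exponent T n p m = int (p div T) - int (m div T) - int (n div T)
     - dl (residue_index T p n \<le> m mod T) - dl (T \<le> residue_index T p n + n mod T)"

lemma Ppoly_eq_lincomb:
  fixes \<Delta> \<alpha> \<beta> :: int and T n p m :: nat
  defines "r \<equiv> residue_index T p n" and "\<mu> \<equiv> Ppoly_exponent T n p m"
  shows "Ppoly \<Delta> T n p m \<alpha> \<beta> = (\<Sum>i=0..p div T. fscale (of_int \<mu> gchoose i)
    (\<Sum>j=\<mu> - int i..\<alpha> + \<beta> - 1 - \<Delta>. fscale (Qs T m \<alpha> r zchoose (j - (\<mu> - int i))) (idem \<Delta> T n m \<alpha> \<beta> r j)))"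
  unfolding fun_eq_iff sum_fun_apply fscale_apply Ppoly_def Let_def r_def \<mu>_def
    Ppoly_exponent_def residue_index_def[symmetric]
  by (auto intro!: sum.cong arg_cong2[where f = "(*)"] simp: zchoose_def algebra_simps)

lemma binom_residue_Ppoly:
  assumes T_pos: "T > 0" and N_ge: "-1 \<le> \<alpha> + \<beta> - 1 - \<Delta>"
    and exponent: "Ppoly_exponent T n p m = - int h - 1"
  shows "binom_residue (of_nat h - Qs T m \<alpha> (residue_index T p n)) (-1) (Ppoly \<Delta> T n p m \<alpha> \<beta>) = 1"
proof -
  define r where "r = residue_index T p n"
  define c where "c = Qs T m \<alpha> r"
  define G where "G i = (\<Sum>j=- int h - 1 - int i..\<alpha> + \<beta> - 1 - \<Delta>.
      fscale (c zchoose (j - (- int h - 1 - int i))) (idem \<Delta> T n m \<alpha> \<beta> r j))" for i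
  have "r < T" using T_pos by (simp add: r_def residue_index_def nat_less_iff)
  have "int h < -1 + int (m div T) + int (n div T) + 3"
    using exponent by (auto simp: Ppoly_exponent_def dl_def split: if_splits)
  note residue = binom_residue_idem[OF T_pos \<open>r < T\<close> N_ge this, folded c_def]
  have laurent_G: "G i \<in> laurent_on UNIV" for i
    unfolding G_def
    by (intro laurent.subspace_sum laurent.subspace_scale subspace_laurent_on idem_laurent_on T_pos)
  have residue_G: "binom_residue (of_nat h - c) (-1) (G i) = (if i = 0 then 1 else 0)" for i
  proof -
    have "binom_residue (of_nat h - c) (-1) (G i) = (\<Sum>j=- int h - 1 - int i..\<alpha> + \<beta> - 1 - \<Delta>.
        (c zchoose (j - (- int h - 1 - int i))) * ((of_nat h - c) zchoose (-1 - j)))"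
      unfolding G_def by (simp add: binom_residue_lincomb idem_laurent_on T_pos residue)
    also have "\<dots> = of_nat h zchoose int (h + i)"
      by (subst zchoose_Vandermonde[OF N_ge]) simp
    also have "\<dots> = (if i = 0 then 1 else 0)"
      unfolding zchoose_of_nat by (simp flip: binomial_gbinomial)
    finally show ?thesis .
  qed
  have "binom_residue (of_nat h - c) (-1) (Ppoly \<Delta> T n p m \<alpha> \<beta>)
      = (\<Sum>i=0..p div T. (of_int (- int h - 1) gchoose i) * (if i = 0 then 1 else 0))"
    unfolding Ppoly_eq_lincomb exponent r_def[symmetric] c_def[symmetric] G_def[symmetric]
    by (simp only: binom_residue_lincomb laurent_G residue_G)
  also have "\<dots> = 1" by (simp add: mult_delta_right)
  finally show ?thesis by (simp only: c_def r_def)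
qed

lemma binom_residue_Ppoly_left_unit:
  assumes "T > 0" "\<Delta> \<le> \<beta>"
  shows "binom_residue 0 (-1) (Ppoly \<Delta> T n n m 0 \<beta>) = 1"
proof -
  have "Ppoly_exponent T n n m = - int (m div T) - 1"
    using assms by (simp add: Ppoly_exponent_def residue_index_def dl_def not_le)
  then have "binom_residue (of_nat (m div T) - Qs T m 0 (residue_index T n n)) (-1) (Ppoly \<Delta> T n n m 0 \<beta>) = 1"
    using assms by (intro binom_residue_Ppoly) auto
  then show ?thesis by (simp add: residue_index_def Qs_def dl_def)
qed

lemma residue_index_decomposition:
  fixes m n T :: nat
  assumes "T > 0"
  defines "r \<equiv> residue_index T m n"
  shows "int m - int n = (int (m div T) - int (n div T) - 1 + dl (r \<le> m mod T)) * int T + int r"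
    and "dl (r \<le> m mod T) + dl (T \<le> r + n mod T) = 1"
proof -
  define i j where "i = m mod T" and "j = n mod T"
  define e where "e = (int m - int n) div int T - int (m div T) + int (n div T)"
  have "int r = (int m - int n) mod int T"
    unfolding r_def residue_index_def using \<open>T > 0\<close> by simp
  then have division: "int m - int n = ((int m - int n) div int T) * int T + int r" by simp
  have "r < T"
    unfolding r_def residue_index_def using \<open>T > 0\<close> by (simp add: nat_less_iff)
  have m_eq: "int m = int (m div T) * int T + int i" and n_eq: "int n = int (n div T) * int T + int j"
    by (simp_all add: i_def j_def flip: of_nat_mult of_nat_add)
  have "i < T" "j < T" using assms by (simp_all add: i_def j_def)
  have e_remainder: "e * int T + int r = int i - int j"
    using division m_eq n_eq by (simp add: e_def left_diff_distrib distrib_right)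
  have "e * int T < 1 * int T" "- 2 * int T < e * int T"
    using e_remainder \<open>r < T\<close> \<open>i < T\<close> \<open>j < T\<close> by linarith+
  then consider "e = 0" | "e = - 1"
    using assms unfolding mult_less_cancel_right by force
  then have e_eq: "e = dl (r \<le> i) - 1" and "dl (r \<le> i) + dl (T \<le> r + j) = 1"
    by (cases; use e_remainder \<open>r < T\<close> \<open>i < T\<close> \<open>j < T\<close> in \<open>auto simp: dl_def\<close>)+
  then show "dl (r \<le> m mod T) + dl (T \<le> r + n mod T) = 1"
    by (simp add: i_def j_def)
  have "(int m - int n) div int T = int (m div T) - int (n div T) - 1 + dl (r \<le> m mod T)"
    using e_eq by (simp add: e_def i_def)
  with division show "int m - int n = (int (m div T) - int (n div T) - 1 + dl (r \<le> m mod T)) * int T + int r"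
    by (simp only:)
qed

definition O0_weight :: "nat \<Rightarrow> nat \<Rightarrow> nat \<Rightarrow> int \<Rightarrow> complex" where
  "O0_weight T n m \<alpha> = of_int \<alpha> + (of_nat m - of_nat n) / of_nat T"

lemma binom_residue_Ppoly_right_unit:
  assumes T_pos: "T > 0" and "\<Delta> \<le> \<alpha>"
  shows "binom_residue (- O0_weight T n m \<alpha>) (-1) (Ppoly \<Delta> T n m m \<alpha> 0) = 1"
proof -
  define r where "r = residue_index T m n"
  note decomposition = residue_index_decomposition[OF T_pos, of m n, folded r_def]
  have "Ppoly_exponent T n m m = - int (n div T) - 1"
    using decomposition(2) by (simp add: Ppoly_exponent_def r_def)
  then have "binom_residue (of_nat (n div T) - Qs T m \<alpha> r) (-1) (Ppoly \<Delta> T n m m \<alpha> 0) = 1"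
    unfolding r_def using assms by (intro binom_residue_Ppoly) auto
  moreover have "of_nat (n div T) - Qs T m \<alpha> r = - O0_weight T n m \<alpha>"
  proof -
    have "of_nat m - of_nat n = (of_int (int m - int n) :: complex)" by simp
    also have "\<dots> = of_int (int (m div T) - int (n div T) - 1 + dl (r \<le> m mod T)) * of_nat T + of_nat r"
      unfolding decomposition(1) by simp
    finally have "(of_nat m - of_nat n :: complex) / of_nat T
        = of_int (int (m div T) - int (n div T) - 1 + dl (r \<le> m mod T)) + of_nat r / of_nat T"
      using T_pos by (simp add: add_divide_distrib)
    then show ?thesis by (simp add: Qs_def O0_weight_def)
  qed
  ultimately show ?thesis by (simp only:)
qed

section \<open>Graded vertex algebras\<close>

locale graded_vertex_algebra =
  fixes V :: "('v::ab_group_add) gVA"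
  assumes graded_VA: "graded_VA V"
begin

sublocale vector_space "scl V"
  using graded_VA unfolding graded_VA_def by (elim conjE)

sublocale vector_space_pair "scl V" "scl V" ..

abbreviation endo :: "('v \<Rightarrow> 'v) \<Rightarrow> bool" where
  "endo \<equiv> Vector_Spaces.linear (scl V) (scl V)"

lemma endo_into_subspace:
  assumes "endo f" "subspace W" "\<And>x. x \<in> S \<Longrightarrow> f x \<in> W" "x \<in> span S"
  shows "f x \<in> W"
proof -
  have "span S \<subseteq> f -` W"
    by (rule span_minimal) (use assms linear_subspace_vimage in auto)
  then show ?thesis using assms(4) by blast
qed

lemma grd_subspace [rule_format]: "\<forall>k. subspace (grd V k)"
  and comp_ex1 [rule_format]:
    "\<forall>v. \<exists>!f. finite {k. f k \<noteq> 0} \<and> (\<forall>k. f k \<in> grd V k) \<and> v = (\<Sum>k\<in>{k. f k \<noteq> 0}. f k)"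
  and grd_below [rule_format]: "\<forall>k. k < Dlt V \<longrightarrow> grd V k = {0}"
  and vac_grd: "vac V \<in> grd V 0"
  and endo_md [rule_format]: "\<forall>a i. endo (md V a i)"
  and endo_md_left [rule_format]: "\<forall>i b. endo (\<lambda>a. md V a i b)"
  and md_grd [rule_format]:
    "\<forall>a b k j i. a \<in> grd V k \<longrightarrow> b \<in> grd V j \<longrightarrow> md V a i b \<in> grd V (k - 1 - i + j)"
  and md_vac_left [rule_format]: "\<forall>i b. md V (vac V) i b = (if i = -1 then b else 0)"
  and md_vac_nonneg [rule_format]: "\<forall>a i. i \<ge> 0 \<longrightarrow> md V a i (vac V) = 0"
  and md_vac_minus_one [rule_format]: "\<forall>a. md V a (-1) (vac V) = a"
  and borcherds [rule_format]: "\<forall>a b c p q r M.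
        (\<forall>i\<ge>M. md V a (r + int i) b = 0 \<and> md V b (q + int i) c = 0 \<and> md V a (p + int i) c = 0) \<longrightarrow>
        (\<Sum>i<M. scl V (of_int p gchoose i) (md V (md V a (r + int i) b) (p + q - int i) c))
      = (\<Sum>i<M. scl V ((-1) ^ i * (of_int r gchoose i))
              (md V a (p + r - int i) (md V b (q + int i) c)
               - scl V ((-1) powi r) (md V b (q + r - int i) (md V a (p + int i) c))))"
  using graded_VA unfolding graded_VA_def by - (elim conjE; assumption)+

lemmas md_zero_right = linear_0[OF endo_md]

subsection \<open>Homogeneous components\<close>

lemma comp_finite: "finite {k. comp V v k \<noteq> 0}"
  and comp_grd: "comp V v k \<in> grd V k"
  and sum_comp: "(\<Sum>k | comp V v k \<noteq> 0. comp V v k) = v"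
  using theI'[OF comp_ex1[of v]] unfolding comp_def[symmetric] by auto

lemma comp_eqI:
  assumes "finite S" "\<And>k. f k \<noteq> 0 \<Longrightarrow> k \<in> S" "\<And>k. f k \<in> grd V k" "v = sum f S"
  shows "comp V v = f"
  unfolding comp_def
proof (rule the1_equality[OF comp_ex1], intro conjI allI)
  show "finite {k. f k \<noteq> 0}" by (rule finite_subset[OF _ assms(1)]) (use assms(2) in auto)
  show "v = (\<Sum>k\<in>{k. f k \<noteq> 0}. f k)"
    unfolding assms(4) by (rule sum.mono_neutral_right) (use assms in auto)
qed (rule assms(3))

lemma comp_homogeneous: "v \<in> grd V k \<Longrightarrow> comp V v = (\<lambda>j. if j = k then v else 0)"
  by (rule comp_eqI[of "{k}"]) (auto simp: subspace_0[OF grd_subspace] split: if_splits)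

lemma endo_comp: "endo (\<lambda>v. comp V v k)"
proof -
  have "comp V (v + w) = (\<lambda>k. comp V v k + comp V w k)" for v w
  proof (rule comp_eqI)
    let ?S = "{k. comp V v k \<noteq> 0} \<union> {k. comp V w k \<noteq> 0}"
    show "finite ?S" using comp_finite by blast
    then have "sum (comp V v) ?S = v" "sum (comp V w) ?S = w"
      by (subst (2) sum_comp[symmetric], intro sum.mono_neutral_right; auto)+
    then show "v + w = (\<Sum>k\<in>?S. comp V v k + comp V w k)" by (simp add: sum.distrib)
  qed (auto simp: comp_grd subspace_add[OF grd_subspace])
  moreover have "comp V (scl V c v) = (\<lambda>k. scl V c (comp V v k))" for c v
    by (rule comp_eqI[OF comp_finite[of v]])
       (auto simp: comp_grd subspace_scale[OF grd_subspace] sum_comp simp flip: scale_sum_right)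
  ultimately show ?thesis by (simp add: Vector_Spaces.linear_iff vector_space_axioms)
qed

lemma endo_homogeneous_sum:
  assumes endo_F: "\<And>k. endo (F k)"
  shows "endo (\<lambda>v. \<Sum>k | comp V v k \<noteq> 0. F k (comp V v k))"
proof -
  have sum_eq: "(\<Sum>k | comp V v k \<noteq> 0. F k (comp V v k)) = (\<Sum>k\<in>S. F k (comp V v k))"
    if "finite S" "\<And>k. comp V v k \<noteq> 0 \<Longrightarrow> k \<in> S" for v S
    by (rule sum.mono_neutral_left) (use that in \<open>auto simp: linear_0[OF endo_F]\<close>)
  have "(\<Sum>k | comp V (v + w) k \<noteq> 0. F k (comp V (v + w) k))
      = (\<Sum>k | comp V v k \<noteq> 0. F k (comp V v k)) + (\<Sum>k | comp V w k \<noteq> 0. F k (comp V w k))" for v w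
  proof -
    let ?S = "{k. comp V v k \<noteq> 0} \<union> {k. comp V w k \<noteq> 0}"
    have "finite ?S" using comp_finite by blast
    then have sum_S: "(\<Sum>k | comp V z k \<noteq> 0. F k (comp V z k)) = (\<Sum>k\<in>?S. F k (comp V z k))"
      if "z \<in> {v, w, v + w}" for z
      by (rule sum_eq) (use that in \<open>auto simp: linear_add[OF endo_comp]\<close>)
    show ?thesis
      by (subst (1 2 3) sum_S) (simp_all add: linear_add[OF endo_comp] linear_add[OF endo_F] sum.distrib)
  qed
  moreover have "(\<Sum>k | comp V (scl V c v) k \<noteq> 0. F k (comp V (scl V c v) k))
      = scl V c (\<Sum>k | comp V v k \<noteq> 0. F k (comp V v k))" for c v
    by (subst sum_eq[OF comp_finite[of v]])
       (auto simp: linear_scale[OF endo_comp] linear_scale[OF endo_F] scale_sum_right)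
  ultimately show ?thesis by (simp add: Vector_Spaces.linear_iff vector_space_axioms)
qed

abbreviation homogeneous :: "'v set" where
  "homogeneous \<equiv> (\<Union>k\<in>{Dlt V..}. grd V k)"

lemma span_homogeneous: "span homogeneous = UNIV"
proof -
  have "comp V v k \<in> span homogeneous" if "comp V v k \<noteq> 0" for v k
    using that comp_grd[of v k] grd_below[of k] by (cases "k < Dlt V") (auto intro!: span_base bexI[of _ k])
  then have "(\<Sum>k | comp V v k \<noteq> 0. comp V v k) \<in> span homogeneous" for v
    by (intro span_sum) simp
  then show ?thesis by (auto simp: sum_comp)
qed

lemma md_truncation:
  assumes "a \<in> grd V k" "b \<in> grd V j" "k + j - Dlt V \<le> i"
  shows "md V a i b = 0"
  using md_grd[OF assms(1,2), of i] grd_below[of "k - 1 - i + j"] assms(3) by auto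

lemma md_translation:
  assumes a_grd: "a \<in> grd V k" and b_grd: "b \<in> grd V j"
  shows "md V (md V a (-2) (vac V)) n b = scl V (- of_int n) (md V a (n - 1) b)"
proof -
  define M where "M = nat (k + j - Dlt V) + nat \<bar>n\<bar> + 2"
  have "md V (md V a (-2) (vac V)) n b
      = (\<Sum>i<M. if i = 0 then md V (md V a (-2) (vac V)) n b else 0)"
    by (simp add: M_def)
  also have "\<dots> = (\<Sum>i<M. scl V (of_int 0 gchoose i) (md V (md V a (-2 + int i) (vac V)) (0 + n - int i) b))"
    by (rule sum.cong) (auto simp: gbinomial_0_left)
  also have "\<dots> = (\<Sum>i<M. scl V ((-1) ^ i * (of_int (-2) gchoose i))
      (md V a (0 + -2 - int i) (md V (vac V) (n + int i) b)
        - scl V ((-1) powi (-2)) (md V (vac V) (n + -2 - int i) (md V a (0 + int i) b))))"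
    by (rule borcherds) (auto simp: M_def md_vac_nonneg md_vac_left intro!: md_truncation[OF a_grd b_grd])
  also have "\<dots> = (\<Sum>i<M. if i = nat (\<bar>n\<bar> - 1) then scl V (- of_int n) (md V a (n - 1) b) else 0)"
  proof (rule sum.cong[OF refl])
    fix i
    consider "n = - 1 - int i" | "n = 1 + int i"
      | "n + int i \<noteq> -1" "n - 2 - int i \<noteq> -1" "n = 0 \<or> i \<noteq> nat (\<bar>n\<bar> - 1)"
      by arith
    then show "scl V ((-1) ^ i * (of_int (-2) gchoose i))
      (md V a (0 + -2 - int i) (md V (vac V) (n + int i) b)
        - scl V ((-1) powi (-2)) (md V (vac V) (n + -2 - int i) (md V a (0 + int i) b)))
      = (if i = nat (\<bar>n\<bar> - 1) then scl V (- of_int n) (md V a (n - 1) b) else 0)"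
      by cases (auto simp: md_vac_left md_zero_right minus_one_power_gbinomial_minus_two
          simp flip: scale_minus_left)
  qed
  also have "\<dots> = scl V (- of_int n) (md V a (n - 1) b)" by (simp add: M_def)
  finally show ?thesis .
qed

lemma md_vac_cong_Suc:
  assumes a_grd: "a \<in> grd V \<alpha>" and subspace_W: "subspace W"
    and translation: "md V a (-2) (vac V) + scl V x a \<in> W"
    and cong: "md V (md V a (-2) (vac V)) (-1 - int i) (vac V)
      - scl V (- x - 1 gchoose i) (md V a (-2) (vac V)) \<in> W"
  shows "md V a (-1 - int (Suc i)) (vac V) - scl V (- x gchoose Suc i) a \<in> W"
proof -
  let ?y = "- x - 1 gchoose i"
  from subspace_add[OF subspace_W cong subspace_scale[OF subspace_W translation, of ?y]]
  have "md V (md V a (-2) (vac V)) (-1 - int i) (vac V) + scl V (?y * x) a \<in> W"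
    by (simp add: scale_right_distrib)
  moreover have "md V (md V a (-2) (vac V)) (-1 - int i) (vac V)
      = scl V (of_nat (Suc i)) (md V a (-1 - int (Suc i)) (vac V))"
    by (subst md_translation[OF a_grd vac_grd]) simp
  ultimately have "scl V (of_nat (Suc i)) (md V a (-1 - int (Suc i)) (vac V)) + scl V (?y * x) a \<in> W"
    by (simp only:)
  from subspace_scale[OF subspace_W this, of "1 / of_nat (Suc i)"]
  have "md V a (-1 - int (Suc i)) (vac V) + scl V (?y * x / of_nat (Suc i)) a \<in> W"
    by (simp add: scale_right_distrib del: of_nat_Suc)
  moreover have "?y * x / of_nat (Suc i) = - (- x gchoose Suc i)"
    using gbinomial_absorption[of i "- x"] by (simp add: field_simps del: of_nat_Suc)
  ultimately show ?thesis by (simp del: of_nat_Suc)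
qed

lemma md_vac_cong_O0:
  assumes "a \<in> grd V \<alpha>"
  shows "md V a k (vac V) - scl V (- O0_weight T n m \<alpha> zchoose (-1 - k)) a \<in> O0 V T n m"
proof (cases "k \<le> -1")
  case True
  have "md V a (-1 - int i) (vac V) - scl V (- O0_weight T n m \<alpha> gchoose i) a \<in> O0 V T n m" for i
    using assms
  proof (induction i arbitrary: a \<alpha>)
    case 0
    then show ?case by (simp add: md_vac_minus_one O0_def span_zero)
  next
    case (Suc i)
    show ?case
    proof (rule md_vac_cong_Suc[OF Suc.prems])
      show "subspace (O0 V T n m)" by (simp add: O0_def)
      show "md V a (-2) (vac V) + scl V (O0_weight T n m \<alpha>) a \<in> O0 V T n m"
        unfolding O0_def O0_weight_def using Suc.prems by (intro span_base) blast
      have "md V a (-2) (vac V) \<in> grd V (\<alpha> + 1)"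
        using md_grd[OF Suc.prems vac_grd, of "-2"] by (simp add: add.commute)
      note Suc.IH[OF this]
      moreover have "- O0_weight T n m (\<alpha> + 1) = - O0_weight T n m \<alpha> - 1"
        by (simp add: O0_weight_def)
      ultimately show "md V (md V a (-2) (vac V)) (-1 - int i) (vac V)
          - scl V (- O0_weight T n m \<alpha> - 1 gchoose i) (md V a (-2) (vac V)) \<in> O0 V T n m"
        by (simp only:)
    qed
  qed
  from this[of "nat (-1 - k)"] True show ?thesis by (simp add: zchoose_nonneg)
next
  case False
  then show ?thesis by (simp add: md_vac_nonneg O0_def span_zero)
qed

subsection \<open>The products\<close>

lemma endo_apl: "endo (apl V f a)" and endo_apl_left: "endo (\<lambda>a. apl V f a b)"
  unfolding apl_def by (intro linear_compose_sum ballI linear_compose_scale_right endo_md endo_md_left)+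

lemma apl_cong_binom_residue:
  assumes subspace_W: "subspace W"
    and md_cong: "\<And>k. md V a k b - scl V (\<rho> zchoose (-1 - k)) w \<in> W"
  shows "apl V f a b - scl V (binom_residue \<rho> (-1) f) w \<in> W"
proof -
  have "apl V f a b - scl V (binom_residue \<rho> (-1) f) w
      = (\<Sum>k | f k \<noteq> 0. scl V (f k) (md V a k b - scl V (\<rho> zchoose (-1 - k)) w))"
    by (simp add: apl_def binom_residue_def scale_sum_left scale_right_diff_distrib sum_subtractf)
  also have "\<dots> \<in> W"
    by (intro subspace_sum[OF subspace_W] subspace_scale[OF subspace_W] md_cong)
  finally show ?thesis .
qed

lemma star_homogeneous:
  assumes "a \<in> grd V \<alpha>" "b \<in> grd V \<beta>"
  shows "star V T n p m a b = apl V (Ppoly (Dlt V) T n p m \<alpha> \<beta>) a b"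
  by (cases "a = 0"; cases "b = 0")
     (simp_all add: star_def comp_homogeneous[OF assms(1)] comp_homogeneous[OF assms(2)]
        linear_0[OF endo_comp] linear_0[OF endo_apl] linear_0[OF endo_apl_left])

lemma endo_star: "endo (star V T n p m a)"
  unfolding star_def by (intro linear_compose_sum ballI endo_homogeneous_sum endo_apl)

lemma endo_star_left: "endo (\<lambda>a. star V T n p m a b)"
  unfolding star_def by (intro endo_homogeneous_sum linear_compose_sum ballI endo_apl_left)

lemma star_bilin: "bilin (scl V) (star V T n p m)"
  by (simp add: bilin_def endo_star endo_star_left)

end

locale graded_vertex_algebra_period = graded_vertex_algebra V
  for V :: "('v::ab_group_add) gVA" +
  fixes T :: nat
  assumes T_pos: "T > 0"
begin

abbreviation star_prod :: "'v \<Rightarrow> nat \<Rightarrow> nat \<Rightarrow> nat \<Rightarrow> 'v \<Rightarrow> 'v" ("(_ \<star>\<^bsub>_,_,_\<^esub> _)" [71, 0, 0, 0, 70] 70) where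
  "a \<star>\<^bsub>n,p,m\<^esub> b \<equiv> star V T n p m a b"

lemma star_vac_left: "vac V \<star>\<^bsub>n,n,m\<^esub> b = b"
proof -
  have on_homogeneous: "vac V \<star>\<^bsub>n,n,m\<^esub> b = b" if "b \<in> homogeneous" for b
  proof -
    from that obtain \<beta> where b_grd: "b \<in> grd V \<beta>" and "Dlt V \<le> \<beta>" by blast
    let ?P = "Ppoly (Dlt V) T n n m 0 \<beta>"
    have "apl V ?P (vac V) b - scl V (binom_residue 0 (-1) ?P) b \<in> {0}"
      by (rule apl_cong_binom_residue) (auto simp: md_vac_left zchoose_0_left)
    then show ?thesis
      by (simp add: star_homogeneous[OF vac_grd b_grd] binom_residue_Ppoly_left_unit[OF T_pos \<open>Dlt V \<le> \<beta>\<close>])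
  qed
  show ?thesis
    by (rule linear_eq_on_span[OF endo_star linear_ident on_homogeneous, where B = homogeneous])
       (simp_all add: span_homogeneous)
qed

lemma star_vac_right: "a \<star>\<^bsub>n,m,m\<^esub> vac V - a \<in> O0 V T n m"
proof -
  have subspace_O0: "subspace (O0 V T n m)" by (simp add: O0_def)
  have endo_defect: "endo (\<lambda>a. a \<star>\<^bsub>n,m,m\<^esub> vac V - a)"
    by (intro linear_compose_sub endo_star_left linear_ident)
  have on_homogeneous: "a \<star>\<^bsub>n,m,m\<^esub> vac V - a \<in> O0 V T n m" if "a \<in> homogeneous" for a
  proof -
    from that obtain \<alpha> where a_grd: "a \<in> grd V \<alpha>" and "Dlt V \<le> \<alpha>" by blast
    from apl_cong_binom_residue[OF subspace_O0 md_vac_cong_O0[OF a_grd], of "Ppoly (Dlt V) T n m m \<alpha> 0"]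
    show ?thesis
      by (simp only: star_homogeneous[OF a_grd vac_grd] scale_one
          binom_residue_Ppoly_right_unit[OF T_pos \<open>Dlt V \<le> \<alpha>\<close>])
  qed
  show ?thesis
    by (rule endo_into_subspace[OF endo_defect subspace_O0 on_homogeneous, where S = homogeneous])
       (simp_all add: span_homogeneous)
qed

subsection \<open>The subspaces \<open>O\<^sub>n\<^sub>,\<^sub>m\<close> as a two-sided ideal\<close>

abbreviation O01 :: "nat \<Rightarrow> nat \<Rightarrow> 'v set" where
  "O01 n m \<equiv> O0 V T n m \<union> O1 V T n m"

definition associator :: "nat \<Rightarrow> nat \<Rightarrow> nat \<Rightarrow> nat \<Rightarrow> 'v \<Rightarrow> 'v \<Rightarrow> 'v \<Rightarrow> 'v" where
  "associator n p2 p1 m a b c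
    = (a \<star>\<^bsub>n,p2,p1\<^esub> b) \<star>\<^bsub>n,p1,m\<^esub> c - a \<star>\<^bsub>n,p2,m\<^esub> (b \<star>\<^bsub>p2,p1,m\<^esub> c)"

lemma subspace_Otot: "subspace (Otot V T n m)"
  by (simp add: Otot_def)

lemma O01_in_Otot: "y \<in> O01 n m \<Longrightarrow> y \<in> Otot V T n m"
  unfolding Otot_def by (blast intro: span_base)

lemma star_associator_in_Otot: "u \<star>\<^bsub>n,q,m\<^esub> associator q p2 p1 m a b c \<in> Otot V T n m"
proof -
  have "u \<star>\<^bsub>n,q,m\<^esub> associator q p2 p1 m a b c \<in> O2 V T n m"
    unfolding O2_def associator_def by (rule span_base) blast
  then show ?thesis unfolding Otot_def by (blast intro: span_base)
qed

lemma star_O01_star_in_Otot: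
  assumes "y \<in> O01 p2 p1"
  shows "(u \<star>\<^bsub>n,p2,p1\<^esub> y) \<star>\<^bsub>n,p1,m\<^esub> c \<in> Otot V T n m"
proof -
  have "0 \<in> O0 V T p2 p1" "0 \<in> O1 V T p2 p1" by (auto simp: O0_def O1_def span_zero)
  with assms have "\<exists>x w. y = x + w \<and> x \<in> O0 V T p2 p1 \<and> w \<in> O1 V T p2 p1"
    by (metis UnE add.left_neutral add.right_neutral)
  then have "(u \<star>\<^bsub>n,p2,p1\<^esub> y) \<star>\<^bsub>n,p1,m\<^esub> c \<in> O3 V T n m"
    unfolding O3_def by (intro span_base) blast
  then show ?thesis unfolding Otot_def by (blast intro: span_base)
qed

lemma endo_Otot_into_subspace:
  assumes endo_f: "endo f" and subspace_W: "subspace W" and "x \<in> Otot V T n m"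
    and O01: "\<And>y. y \<in> O01 n m \<Longrightarrow> f y \<in> W"
    and associator: "\<And>q p2 p1 u a b c. f (u \<star>\<^bsub>n,q,m\<^esub> associator q p2 p1 m a b c) \<in> W"
    and star_O01_star: "\<And>p2 p1 u y c. y \<in> O01 p2 p1 \<Longrightarrow> f ((u \<star>\<^bsub>n,p2,p1\<^esub> y) \<star>\<^bsub>n,p1,m\<^esub> c) \<in> W"
  shows "f x \<in> W"
proof (rule endo_into_subspace[OF endo_f subspace_W _ \<open>x \<in> Otot V T n m\<close>[unfolded Otot_def]])
  have "f x \<in> W" if "x \<in> O2 V T n m" for x
    by (rule endo_into_subspace[OF endo_f subspace_W _ that[unfolded O2_def]])
       (use associator in \<open>auto simp: associator_def\<close>)
  moreover have "f x \<in> W" if "x \<in> O3 V T n m" for x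
    by (rule endo_into_subspace[OF endo_f subspace_W _ that[unfolded O3_def]])
       (clarsimp simp: linear_add[OF endo_star] linear_add[OF endo_star_left] linear_add[OF endo_f],
        intro subspace_add[OF subspace_W] star_O01_star; simp)
  ultimately show "f x \<in> W" if "x \<in> O0 V T n m \<union> O1 V T n m \<union> O2 V T n m \<union> O3 V T n m" for x
    using that O01 by blast
qed

lemma associator_in_Otot: "associator n p2 p1 m a b c \<in> Otot V T n m"
  using star_associator_in_Otot[where u = "vac V" and n = n and q = n] by (simp add: star_vac_left)

lemma star_star_associator_in_Otot:
  "u \<star>\<^bsub>n,q,m\<^esub> (v \<star>\<^bsub>q,p,m\<^esub> associator p p2 p1 m a b c) \<in> Otot V T n m"
proof -
  let ?z = "associator p p2 p1 m a b c"
  have "(u \<star>\<^bsub>n,q,p\<^esub> v) \<star>\<^bsub>n,p,m\<^esub> ?z - associator n q p m u v ?z \<in> Otot V T n m"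
    by (intro subspace_diff subspace_Otot star_associator_in_Otot associator_in_Otot)
  then show ?thesis by (simp add: associator_def[of n q p])
qed

lemma associator_pentagon:
  "associator q p2 p1 p a b c \<star>\<^bsub>q,p,m\<^esub> d
    = associator q p1 p m (a \<star>\<^bsub>q,p2,p1\<^esub> b) c d + associator q p2 p1 m a b (c \<star>\<^bsub>p1,p,m\<^esub> d)
      - associator q p2 p m a (b \<star>\<^bsub>p2,p1,p\<^esub> c) d - a \<star>\<^bsub>q,p2,m\<^esub> associator p2 p1 p m b c d"
  by (simp add: associator_def linear_diff[OF endo_star] linear_diff[OF endo_star_left])

lemma Otot_star:
  assumes "x \<in> Otot V T n p"
  shows "x \<star>\<^bsub>n,p,m\<^esub> d \<in> Otot V T n m"
proof (rule endo_Otot_into_subspace[OF endo_star_left subspace_Otot assms])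
  show "y \<star>\<^bsub>n,p,m\<^esub> d \<in> Otot V T n m" if "y \<in> O01 n p" for y
    using star_O01_star_in_Otot[OF that, where u = "vac V" and n = n] by (simp add: star_vac_left)
next
  fix q p2 p1 u a b c
  let ?A = "associator q p2 p1 p a b c"
  have "u \<star>\<^bsub>n,q,m\<^esub> (?A \<star>\<^bsub>q,p,m\<^esub> d) \<in> Otot V T n m"
    unfolding associator_pentagon linear_diff[OF endo_star] linear_add[OF endo_star]
    by (intro subspace_diff subspace_add subspace_Otot star_associator_in_Otot star_star_associator_in_Otot)
  then have "associator n q p m u ?A d + u \<star>\<^bsub>n,q,m\<^esub> (?A \<star>\<^bsub>q,p,m\<^esub> d) \<in> Otot V T n m"
    by (rule subspace_add[OF subspace_Otot associator_in_Otot])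
  then show "(u \<star>\<^bsub>n,q,p\<^esub> ?A) \<star>\<^bsub>n,p,m\<^esub> d \<in> Otot V T n m"
    by (simp add: associator_def[of n q p])
next
  fix p2 p1 u y c assume "y \<in> O01 p2 p1"
  then have "associator n p1 p m (u \<star>\<^bsub>n,p2,p1\<^esub> y) c d
      + (u \<star>\<^bsub>n,p2,p1\<^esub> y) \<star>\<^bsub>n,p1,m\<^esub> (c \<star>\<^bsub>p1,p,m\<^esub> d) \<in> Otot V T n m"
    by (intro subspace_add subspace_Otot associator_in_Otot star_O01_star_in_Otot)
  then show "((u \<star>\<^bsub>n,p2,p1\<^esub> y) \<star>\<^bsub>n,p1,p\<^esub> c) \<star>\<^bsub>n,p,m\<^esub> d \<in> Otot V T n m"
    by (simp add: associator_def)
qed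

lemma star_Otot:
  assumes "x \<in> Otot V T p m"
  shows "u \<star>\<^bsub>n,p,m\<^esub> x \<in> Otot V T n m"
proof (rule endo_Otot_into_subspace[OF endo_star subspace_Otot assms])
  fix y assume y_O01: "y \<in> O01 p m"
  let ?z = "u \<star>\<^bsub>n,p,m\<^esub> y"
  have "?z \<star>\<^bsub>n,m,m\<^esub> vac V - ?z \<in> Otot V T n m"
    by (intro O01_in_Otot UnI1 star_vac_right)
  with star_O01_star_in_Otot[OF y_O01]
  have "?z \<star>\<^bsub>n,m,m\<^esub> vac V - (?z \<star>\<^bsub>n,m,m\<^esub> vac V - ?z) \<in> Otot V T n m"
    by (rule subspace_diff[OF subspace_Otot])
  then show "?z \<in> Otot V T n m" by simp
next
  fix q p2 p1 v a b c
  show "u \<star>\<^bsub>n,p,m\<^esub> (v \<star>\<^bsub>p,q,m\<^esub> associator q p2 p1 m a b c) \<in> Otot V T n m"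
    by (rule star_star_associator_in_Otot)
next
  fix p2 p1 v y c assume y_O01: "y \<in> O01 p2 p1"
  let ?vy = "v \<star>\<^bsub>p,p2,p1\<^esub> y"
  have "((u \<star>\<^bsub>n,p,p2\<^esub> v) \<star>\<^bsub>n,p2,p1\<^esub> y) \<star>\<^bsub>n,p1,m\<^esub> c - associator n p p2 p1 u v y \<star>\<^bsub>n,p1,m\<^esub> c
      - associator n p p1 m u ?vy c \<in> Otot V T n m"
    by (intro subspace_diff subspace_Otot star_O01_star_in_Otot[OF y_O01] Otot_star associator_in_Otot)
  then show "u \<star>\<^bsub>n,p,m\<^esub> (?vy \<star>\<^bsub>p,p1,m\<^esub> c) \<in> Otot V T n m"
    by (simp add: associator_def linear_diff[OF endo_star_left])
qed

lemma star_well_defined: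
  assumes "a - a' \<in> Otot V T n p" "b - b' \<in> Otot V T p m"
  shows "a \<star>\<^bsub>n,p,m\<^esub> b - a' \<star>\<^bsub>n,p,m\<^esub> b' \<in> Otot V T n m"
proof -
  have "(a - a') \<star>\<^bsub>n,p,m\<^esub> b + a' \<star>\<^bsub>n,p,m\<^esub> (b - b') \<in> Otot V T n m"
    by (intro subspace_add subspace_Otot Otot_star star_Otot assms)
  then show ?thesis by (simp add: linear_diff[OF endo_star] linear_diff[OF endo_star_left])
qed

end

theorem mainTheorem10:
  fixes V :: "('v::ab_group_add) gVA" and T mm nn :: nat
  assumes "graded_VA V" and "T > 0"
  shows
   \<comment> \<open>A^T_m(V): *^T_{m,m,m} is well defined on V / O^T_{m,m}(V), bilinear, associative, unit [1]\<close>
   "(\<forall>a a' b b'. a - a' \<in> Otot V T mm mm \<longrightarrow> b - b' \<in> Otot V T mm mm \<longrightarrow>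
        star V T mm mm mm a b - star V T mm mm mm a' b' \<in> Otot V T mm mm)
  \<and> bilin (scl V) (star V T mm mm mm)
  \<and> (\<forall>a b c. star V T mm mm mm (star V T mm mm mm a b) c
             - star V T mm mm mm a (star V T mm mm mm b c) \<in> Otot V T mm mm)
  \<and> (\<forall>a. star V T mm mm mm (vac V) a - a \<in> Otot V T mm mm
        \<and> star V T mm mm mm a (vac V) - a \<in> Otot V T mm mm)
   \<comment> \<open>A^T_{n,m}(V) is an A^T_n(V)-A^T_m(V)-bimodule\<close>
  \<and> (\<forall>a a' b b'. a - a' \<in> Otot V T nn nn \<longrightarrow> b - b' \<in> Otot V T nn mm \<longrightarrow>
        star V T nn nn mm a b - star V T nn nn mm a' b' \<in> Otot V T nn mm)
  \<and> (\<forall>b b' c c'. b - b' \<in> Otot V T nn mm \<longrightarrow> c - c' \<in> Otot V T mm mm \<longrightarrow>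
        star V T nn mm mm b c - star V T nn mm mm b' c' \<in> Otot V T nn mm)
  \<and> bilin (scl V) (star V T nn nn mm)
  \<and> bilin (scl V) (star V T nn mm mm)
  \<and> (\<forall>a a' b. star V T nn nn mm (star V T nn nn nn a a') b
             - star V T nn nn mm a (star V T nn nn mm a' b) \<in> Otot V T nn mm)
  \<and> (\<forall>b. star V T nn nn mm (vac V) b - b \<in> Otot V T nn mm)
  \<and> (\<forall>b c c'. star V T nn mm mm (star V T nn mm mm b c) c'
             - star V T nn mm mm b (star V T mm mm mm c c') \<in> Otot V T nn mm)
  \<and> (\<forall>b. star V T nn mm mm b (vac V) - b \<in> Otot V T nn mm)
  \<and> (\<forall>a b c. star V T nn mm mm (star V T nn nn mm a b) c
             - star V T nn nn mm a (star V T nn mm mm b c) \<in> Otot V T nn mm)"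
proof -
  interpret graded_vertex_algebra_period V T using assms by unfold_locales
  have left_unit: "star V T n n m (vac V) b - b \<in> Otot V T n m" for n m b
    using subspace_0[OF subspace_Otot] by (simp add: star_vac_left)
  have right_unit: "star V T n m m a (vac V) - a \<in> Otot V T n m" for n m a
    using star_vac_right O01_in_Otot by blast
  show ?thesis
    by (intro conjI allI impI star_well_defined star_bilin left_unit right_unit
        associator_in_Otot[unfolded associator_def])
qed

end
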